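(* Not all Hylland–Zeckhauser (HZ) equilibria come from VCG. Namely, consider $4$ players and $4$ items $A,B,C,D$ with utility vectors (in the order $A,B,C,D$) $u_1=u_2=(11,9,14,0)$ and $u_3=u_4=(0,0,10,0)$. The prices $(P_A,P_B,P_C,P_D)=(1.1,\,0.9,\,2,\,0)$ and the allocation $x$ with $x_1=x_2=(\tfrac12,\tfrac12,0,0)$, $x_3=x_4=(0,0,\tfrac12,\tfrac12)$ form an HZ equilibrium. However, there is no probability distribution on pairs $(\lambda,\pi)$, with $\lambda=(\lambda_1,\lambda_2,\lambda_3,\lambda_4)\in[0,\infty)^4$ and $\pi$ a one-to-one assignment of items to players that is optimal for the utilities $(\lambda_1u_1,\lambda_2u_2,\lambda_3u_3,\lambda_4u_4)$, such that both (i) the expected allocation (the probability that $\pi$ gives item $j$ to player $i$) equals $x_{ij}$ for all $i,j$, and (ii) for each player $i$, the expected VCG payment of player $i$ equals $1$.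
   Context: HZ equilibrium. For $n$ players and $n$ items with utilities $u_{ij}\ge0$, prices $P_j\ge0$ and a nonnegative matrix $x$ with $\sum_jx_{ij}=1$ for all $i$ form an HZ equilibrium if: $\sum_ix_{ij}=1$ for all $j$; $\sum_jP_jx_{ij}\le1$ for all $i$; and for each $i$ and each $y\ge0$ with $\sum_jy_j=1$ and $\sum_jP_jy_j\le1$ one has $\sum_ju_{ij}y_j\le\sum_ju_{ij}x_{ij}$. An assignment $\pi$ (bijection from players to items) is optimal for utilities $v$ if it maximizes $\sum_kv_{k\pi(k)}$. The VCG payment of player $i$ under utilities $v$ and an optimal assignment $\pi$ is $\max_\sigma\sum_{k\ne i}v_{k\sigma(k)}-\sum_{k\ne i}v_{k\pi(k)}$, the maximum being over all bijections $\sigma$ from players to items. *)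

theory Defs
  imports "HOL-Probability.Probability"
begin

text \<open>
  Players and items are the finite index types \<open>'p\<close> and \<open>'i\<close>; a matrix entry is \<open>u $ player $ item\<close>.
  There are equally many players and items: \<open>hz_equilibrium\<close> forces this, since all rows and all
  columns of \<open>x\<close> sum to 1, and an assignment is a bijection \<open>'p \<Rightarrow> 'i\<close>.
\<close>

definition hz_equilibrium :: "real^'i^'p \<Rightarrow> real^'i \<Rightarrow> real^'i^'p \<Rightarrow> bool" where
  "hz_equilibrium u P x \<longleftrightarrow>
     (\<forall>i j. 0 \<le> u $ i $ j) \<and> (\<forall>j. 0 \<le> P $ j) \<and> (\<forall>i j. 0 \<le> x $ i $ j) \<and>
     (\<forall>i. (\<Sum>j\<in>UNIV. x $ i $ j) = 1) \<and>
     (\<forall>j. (\<Sum>i\<in>UNIV. x $ i $ j) = 1) \<and>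
     (\<forall>i. (\<Sum>j\<in>UNIV. P $ j * x $ i $ j) \<le> 1) \<and>
     (\<forall>i. \<forall>y :: real^'i.
        (\<forall>j. 0 \<le> y $ j) \<longrightarrow> (\<Sum>j\<in>UNIV. y $ j) = 1 \<longrightarrow> (\<Sum>j\<in>UNIV. P $ j * y $ j) \<le> 1 \<longrightarrow>
        (\<Sum>j\<in>UNIV. u $ i $ j * y $ j) \<le> (\<Sum>j\<in>UNIV. u $ i $ j * x $ i $ j))"

definition optimal_assignment :: "real^'i^'p \<Rightarrow> ('p \<Rightarrow> 'i) \<Rightarrow> bool" where
  "optimal_assignment v \<pi> \<longleftrightarrow>
     bij \<pi> \<and> (\<forall>\<sigma>. bij \<sigma> \<longrightarrow> (\<Sum>k\<in>UNIV. v $ k $ \<sigma> k) \<le> (\<Sum>k\<in>UNIV. v $ k $ \<pi> k))"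

definition vcg_payment :: "real^'i^'p \<Rightarrow> ('p \<Rightarrow> 'i) \<Rightarrow> 'p \<Rightarrow> real" where
  "vcg_payment v \<pi> i =
     Max ((\<lambda>\<sigma>. \<Sum>k\<in>UNIV - {i}. v $ k $ \<sigma> k) ` {\<sigma>. bij \<sigma>}) - (\<Sum>k\<in>UNIV - {i}. v $ k $ \<pi> k)"

definition scaled_utilities :: "real^'p \<Rightarrow> real^'i^'p \<Rightarrow> real^'i^'p" where
  "scaled_utilities l u = (\<chi> i. (l $ i) *\<^sub>R (u $ i))"

text \<open>
  Probability distributions on pairs \<open>(l, \<pi>)\<close> of a scaling vector and an assignment: arbitrary Borel
  distributions (discrete or not), living on all pairs but concentrated on the admissible ones.
\<close>

definition scaled_assignment_distr :: "real^'i^'p \<Rightarrow> ((real^'p) \<times> ('p \<Rightarrow> 'i)) measure \<Rightarrow> bool" where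
  "scaled_assignment_distr u M \<longleftrightarrow>
     prob_space M \<and> sets M = sets (borel \<Otimes>\<^sub>M count_space UNIV) \<and>
     (AE (l, \<pi>) in M. (\<forall>i. 0 \<le> l $ i) \<and> optimal_assignment (scaled_utilities l u) \<pi>)"

end

theory Submission
  imports Defs
begin

text \<open>
  Almost surely players 1, 2 share \<open>A\<close>, \<open>B\<close> and players 3, 4 share \<open>C\<close>, \<open>D\<close>. Let \<open>a \<ge> b\<close> be the
  scalings of the players getting \<open>A\<close> and \<open>B\<close>. In an optimal assignment the winner of \<open>A\<close> pays at
  most \<open>2 b\<close> and the winner of \<open>B\<close> pays nothing, while the winner of \<open>C\<close> displaces the two others
  and pays at least \<open>3 a + 2 b \<ge> 5 b\<close>. Taking expectations, the total payment of players 3, 4 is at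
  least \<open>5/2\<close> times that of players 1, 2, which is incompatible with all expected payments being 1.
\<close>

lemma vcg_payment_le:
  fixes v :: "real^'i^'p"
  assumes "bij \<pi>"
    and "\<And>\<sigma>. bij \<sigma> \<Longrightarrow> (\<Sum>k\<in>UNIV - {i}. v $ k $ \<sigma> k) \<le> (\<Sum>k\<in>UNIV - {i}. v $ k $ \<pi> k) + c"
  shows "vcg_payment v \<pi> i \<le> c"
proof -
  let ?S = "(\<lambda>\<sigma>. \<Sum>k\<in>UNIV - {i}. v $ k $ \<sigma> k) ` {\<sigma>. bij \<sigma>}"
  have "Max ?S \<le> (\<Sum>k\<in>UNIV - {i}. v $ k $ \<pi> k) + c"
    using assms by (subst Max_le_iff) auto
  then show ?thesis unfolding vcg_payment_def by simp
qed

lemma vcg_payment_ge: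
  fixes v :: "real^'i^'p"
  assumes "bij \<sigma>"
    and "(\<Sum>k\<in>UNIV - {i}. v $ k $ \<pi> k) + c \<le> (\<Sum>k\<in>UNIV - {i}. v $ k $ \<sigma> k)"
  shows "c \<le> vcg_payment v \<pi> i"
proof -
  let ?S = "(\<lambda>\<sigma>. \<Sum>k\<in>UNIV - {i}. v $ k $ \<sigma> k) ` {\<sigma>. bij \<sigma>}"
  have "(\<Sum>k\<in>UNIV - {i}. v $ k $ \<sigma> k) \<le> Max ?S"
    using assms by (intro Max_ge) auto
  with assms(2) show ?thesis unfolding vcg_payment_def by linarith
qed

lemma vector_4:
  "(vector [x1, x2, x3, x4] :: 'a::zero^4) $ 1 = x1"
  "(vector [x1, x2, x3, x4] :: 'a::zero^4) $ 2 = x2"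
  "(vector [x1, x2, x3, x4] :: 'a::zero^4) $ 3 = x3"
  "(vector [x1, x2, x3, x4] :: 'a::zero^4) $ 4 = x4"
  unfolding vector_def by simp_all

text \<open>Naming the players by the items they win, \<open>p\<close> for A, \<open>q\<close> for
  B, \<open>r\<close> for C and \<open>s\<close> for D, covers all four assignments of the main
  proof at once, since players with equal utilities may be interchanged.\<close>

lemma payment_ratio:
  fixes u :: "real^4^4" and l :: "real^4"
  assumes distinct: "distinct [p, q, r, s]"
    and u: "u $ p = vector [11, 9, 14, 0]" "u $ q = vector [11, 9, 14, 0]"
           "u $ r = vector [0, 0, 10, 0]" "u $ s = vector [0, 0, 10, 0]"
    and l: "\<And>i. 0 \<le> l $ i"
    and opt: "optimal_assignment (scaled_utilities l u) \<pi>"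
    and \<pi>: "\<pi> p = 1" "\<pi> q = 2" "\<pi> r = 3" "\<pi> s = 4"
  shows "5 * (vcg_payment (scaled_utilities l u) \<pi> p + vcg_payment (scaled_utilities l u) \<pi> q)
    \<le> 2 * (vcg_payment (scaled_utilities l u) \<pi> r + vcg_payment (scaled_utilities l u) \<pi> s)"
proof -
  have players: "UNIV = {p, q, r, s}"
    using distinct by (intro card_seteq[symmetric]) auto
  \<comment> \<open>The reversed list gives simp the inequalities between players in the other
    orientation.\<close>
  have distinct': "distinct [s, r, q, p]"
    using distinct by auto
  define v where "v = scaled_utilities l u"
  have v: "v $ i $ j = l $ i * u $ i $ j" for i j
    by (simp add: v_def scaled_utilities_def)
  have sums: "(\<Sum>k\<in>UNIV. f k) = f p + f q + f r + f s"
    "(\<Sum>k\<in>UNIV - {p}. f k) = f q + f r + f s" "(\<Sum>k\<in>UNIV - {q}. f k) = f p + f r + f s"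
    "(\<Sum>k\<in>UNIV - {r}. f k) = f p + f q + f s" "(\<Sum>k\<in>UNIV - {s}. f k) = f p + f q + f r"
    for f :: "4 \<Rightarrow> real"
  proof -
    have "UNIV - {p} = {q, r, s}" "UNIV - {q} = {p, r, s}"
      "UNIV - {r} = {p, q, s}" "UNIV - {s} = {p, q, r}"
      using players distinct by auto
    with distinct show "(\<Sum>k\<in>UNIV. f k) = f p + f q + f r + f s"
      "(\<Sum>k\<in>UNIV - {p}. f k) = f q + f r + f s" "(\<Sum>k\<in>UNIV - {q}. f k) = f p + f r + f s"
      "(\<Sum>k\<in>UNIV - {r}. f k) = f p + f q + f s" "(\<Sum>k\<in>UNIV - {s}. f k) = f p + f q + f r"
      by (simp_all add: players add.assoc)
  qed
  have best: "(\<Sum>k\<in>UNIV. v $ k $ \<sigma> k) \<le> (\<Sum>k\<in>UNIV. v $ k $ \<pi> k)"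
    if "bij \<sigma>" for \<sigma>
    using opt that by (auto simp: optimal_assignment_def v_def)
  have bij: "bij \<pi>" using opt by (simp add: optimal_assignment_def)
  have lin: "l $ p \<ge> 0" "l $ q \<ge> 0" "l $ r \<ge> 0" "l $ s \<ge> 0" by (simp_all add: l)
  \<comment> \<open>Exchanging A and B would change the welfare by
    \<open>2 * (l $ q - l $ p)\<close>.\<close>
  have qp: "l $ q \<le> l $ p"
    using best[of "\<pi> \<circ> Transposition.transpose p q"] bij distinct distinct'
    by (simp add: sums v u \<pi> vector_4 bij_comp Transposition.transpose_def)
  have sr: "l $ s \<le> l $ r"
    using best[of "\<pi> \<circ> Transposition.transpose r s"] bij distinct distinct'
    by (simp add: sums v u \<pi> vector_4 bij_comp Transposition.transpose_def)
  \<comment> \<open>Three-way exchange: \<open>p\<close> moves to C, \<open>q\<close> to A,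
    \<open>r\<close> to B. It is used twice, against the optimality of \<pi> to get
    \<open>C\<close>, and below as the reallocation that \<open>r\<close> displaces.\<close>
  define \<tau> where "\<tau> = \<pi> \<circ> Transposition.transpose p q \<circ> Transposition.transpose p r"
  have \<tau>: "bij \<tau>" "\<tau> p = 3" "\<tau> q = 1" "\<tau> r = 2" "\<tau> s = 4"
    using distinct distinct' bij by (auto simp: \<tau>_def \<pi> Transposition.transpose_def intro!: bij_comp)
  have C: "3 * l $ p + 2 * l $ q \<le> 10 * l $ r"
    using best[OF \<tau>(1)] by (simp add: sums v u \<pi> \<tau> vector_4)
  have item: "j = 1 \<or> j = 2 \<or> j = 3 \<or> j = 4" for j :: 4
    by (rule exhaust_4)
  have inj: "\<sigma> i = \<sigma> j \<longleftrightarrow> i = j" if "bij \<sigma>" for \<sigma> :: "4 \<Rightarrow> 4" and i j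
    using that by (simp add: bij_is_inj inj_eq)
  \<comment> \<open>Without \<open>p\<close>, the best use of A is to give it to \<open>q\<close>, a
    gain of \<open>2 * l $ q\<close>. Moving \<open>q\<close> to C instead gains
    \<open>3 * l $ q\<close> but costs \<open>10 * l $ r\<close>, which is no less by
    \<open>C\<close>.\<close>
  have "vcg_payment v \<pi> p \<le> 2 * l $ q"
  proof (rule vcg_payment_le[OF bij])
    fix \<sigma> :: "4 \<Rightarrow> 4" assume "bij \<sigma>"
    then have "\<sigma> q \<noteq> \<sigma> r" "\<sigma> q \<noteq> \<sigma> s" "\<sigma> r \<noteq> \<sigma> s"
      using distinct by (simp_all add: inj)
    then show "(\<Sum>k\<in>UNIV - {p}. v $ k $ \<sigma> k) \<le> (\<Sum>k\<in>UNIV - {p}. v $ k $ \<pi> k) + 2 * l $ q"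
      using item[of "\<sigma> q"] item[of "\<sigma> r"] item[of "\<sigma> s"] lin C qp sr
      by (elim disjE) (simp_all add: sums v u \<pi> vector_4)
  qed
  \<comment> \<open>The only item that \<open>p\<close> prefers to A is C, and taking it from
    \<open>r\<close> does not pay because of \<open>C\<close>.\<close>
  moreover have "vcg_payment v \<pi> q \<le> 0"
  proof (rule vcg_payment_le[OF bij])
    fix \<sigma> :: "4 \<Rightarrow> 4" assume "bij \<sigma>"
    then have "\<sigma> p \<noteq> \<sigma> r" "\<sigma> p \<noteq> \<sigma> s" "\<sigma> r \<noteq> \<sigma> s"
      using distinct by (simp_all add: inj)
    then show "(\<Sum>k\<in>UNIV - {q}. v $ k $ \<sigma> k) \<le> (\<Sum>k\<in>UNIV - {q}. v $ k $ \<pi> k) + 0"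
      using item[of "\<sigma> p"] item[of "\<sigma> r"] item[of "\<sigma> s"] lin C qp sr
      by (elim disjE) (simp_all add: sums v u \<pi> vector_4)
  qed
  moreover have "3 * l $ p + 2 * l $ q \<le> vcg_payment v \<pi> r"
    by (rule vcg_payment_ge[OF \<tau>(1)]) (simp add: sums v u \<pi> \<tau> vector_4)
  moreover have "0 \<le> vcg_payment v \<pi> s"
    by (rule vcg_payment_ge[OF bij]) simp
  \<comment> \<open>The factor comes from
    \<open>5 * (2 * l $ q) \<le> 2 * (3 * l $ p + 2 * l $ q)\<close>, that is, from
    \<open>qp\<close>.\<close>
  ultimately show ?thesis using qp lin unfolding v_def by argo
qed

theorem mainTheorem4:
  fixes u x :: "real^4^4" and P :: "real^4"
  assumes "u = vector [vector [11, 9, 14, 0], vector [11, 9, 14, 0],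
                       vector [0, 0, 10, 0], vector [0, 0, 10, 0]]"
    and "P = vector [11/10, 9/10, 2, 0]"
    and "x = vector [vector [1/2, 1/2, 0, 0], vector [1/2, 1/2, 0, 0],
                     vector [0, 0, 1/2, 1/2], vector [0, 0, 1/2, 1/2]]"
  shows "hz_equilibrium u P x \<and>
    \<not> (\<exists>M. scaled_assignment_distr u M \<and>
           (\<forall>i j. \<P>((l, \<pi>) in M. \<pi> i = j) = x $ i $ j) \<and>
           (\<forall>i. integrable M (\<lambda>(l, \<pi>). vcg_payment (scaled_utilities l u) \<pi> i) \<and>
                (\<integral>(l, \<pi>). vcg_payment (scaled_utilities l u) \<pi> i \<partial>M) = 1))"
proof
  note defs = assms vector_4
  \<comment> \<open>Itemwise, the utilities are at most \<open>10 * P\<close> for players 1, 2 and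
    at most \<open>5 * P\<close> for players 3, 4. The budget thus caps utility at 10 and 5, which
    \<open>x\<close> attains.\<close>
  show "hz_equilibrium u P x"
    unfolding hz_equilibrium_def by (auto simp: defs forall_4 sum_4)
  show "\<not> (\<exists>M. scaled_assignment_distr u M \<and>
           (\<forall>i j. \<P>((l, \<pi>) in M. \<pi> i = j) = x $ i $ j) \<and>
           (\<forall>i. integrable M (\<lambda>(l, \<pi>). vcg_payment (scaled_utilities l u) \<pi> i) \<and>
                (\<integral>(l, \<pi>). vcg_payment (scaled_utilities l u) \<pi> i \<partial>M) = 1))"
  proof (intro notI, elim exE conjE)
    fix M :: "((real^4) \<times> (4 \<Rightarrow> 4)) measure"
    assume distr: "scaled_assignment_distr u M"
      and alloc: "\<forall>i j. \<P>((l, \<pi>) in M. \<pi> i = j) = x $ i $ j"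
      and pay: "\<forall>i. integrable M (\<lambda>(l, \<pi>). vcg_payment (scaled_utilities l u) \<pi> i) \<and>
                (\<integral>(l, \<pi>). vcg_payment (scaled_utilities l u) \<pi> i \<partial>M) = 1"
    from distr interpret prob_space M by (simp add: scaled_assignment_distr_def)
    have sets: "sets M = sets (borel \<Otimes>\<^sub>M count_space UNIV)"
      using distr by (simp add: scaled_assignment_distr_def)
    define f where "f i = (\<lambda>(l, \<pi>). vcg_payment (scaled_utilities l u) \<pi> i)" for i
    have int: "integrable M (f i)" and E: "integral\<^sup>L M (f i) = 1" for i
      using pay by (simp_all add: f_def)
    have avoid: "AE (l, \<pi>) in M. \<pi> i \<noteq> j" if "x $ i $ j = 0" for i j
    proof -
      \<comment> \<open>Measurability matters here: \<open>prob\<close> is 0 by default outside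
        \<open>events\<close>, so a zero value alone would not give an almost sure
        statement.\<close>
      have "(\<lambda>\<omega>. snd \<omega> i) \<in> M \<rightarrow>\<^sub>M count_space UNIV"
        unfolding measurable_cong_sets[OF sets refl]
        by (rule measurable_compose[OF measurable_snd]) simp
      then have "{\<omega> \<in> space M. snd \<omega> i = j} \<in> events"
        by measurable
      moreover have "prob {\<omega> \<in> space M. snd \<omega> i = j} = 0"
        using alloc[rule_format, of i j] that by (simp add: case_prod_beta')
      ultimately have "AE \<omega> in M. \<not> (snd \<omega> i = j)"
        by (subst (asm) prob_eq_0) (auto elim: AE_mp)
      then show ?thesis by (simp add: case_prod_beta')
    qed
    have "AE \<omega> in M. 5 * (f 1 \<omega> + f 2 \<omega>) \<le> 2 * (f 3 \<omega> + f 4 \<omega>)"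
    proof -
      have opt: "AE (l, \<pi>) in M. (\<forall>i. 0 \<le> l $ i) \<and>
          optimal_assignment (scaled_utilities l u) \<pi>"
        using distr by (simp add: scaled_assignment_distr_def)
      have x0: "x $ 1 $ 3 = 0" "x $ 1 $ 4 = 0" "x $ 2 $ 3 = 0" "x $ 2 $ 4 = 0"
        "x $ 3 $ 1 = 0" "x $ 3 $ 2 = 0" "x $ 4 $ 1 = 0" "x $ 4 $ 2 = 0"
        by (simp_all add: defs)
      show ?thesis
        using opt x0[THEN avoid]
      proof eventually_elim
        case (elim \<omega>)
        obtain l \<pi> where \<omega>: "\<omega> = (l, \<pi>)" by (cases \<omega>)
        have l: "\<And>i. 0 \<le> l $ i" and opt: "optimal_assignment (scaled_utilities l u) \<pi>"
          using elim(1) by (auto simp: \<omega>)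
        have uv: "u $ 1 = vector [11, 9, 14, 0]" "u $ 2 = vector [11, 9, 14, 0]"
          "u $ 3 = vector [0, 0, 10, 0]" "u $ 4 = vector [0, 0, 10, 0]"
          by (simp_all add: defs)
        have inj: "inj \<pi>"
          using opt by (simp add: optimal_assignment_def bij_is_inj)
        have "\<pi> 1 \<noteq> \<pi> 2" "\<pi> 3 \<noteq> \<pi> 4"
          by (simp_all add: inj_eq[OF inj])
        moreover have "\<pi> 1 = 1 \<or> \<pi> 1 = 2" "\<pi> 2 = 1 \<or> \<pi> 2 = 2"
            "\<pi> 3 = 3 \<or> \<pi> 3 = 4" "\<pi> 4 = 3 \<or> \<pi> 4 = 4"
          using elim exhaust_4[of "\<pi> 1"] exhaust_4[of "\<pi> 2"] exhaust_4[of "\<pi> 3"]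
            exhaust_4[of "\<pi> 4"] by (auto simp: \<omega>)
        \<comment> \<open>Each case lists its equations by item, in the order of the last premises
          of \<open>payment_ratio\<close>.\<close>
        ultimately consider
            "\<pi> 1 = 1" "\<pi> 2 = 2" "\<pi> 3 = 3" "\<pi> 4 = 4"
          | "\<pi> 2 = 1" "\<pi> 1 = 2" "\<pi> 3 = 3" "\<pi> 4 = 4"
          | "\<pi> 1 = 1" "\<pi> 2 = 2" "\<pi> 4 = 3" "\<pi> 3 = 4"
          | "\<pi> 2 = 1" "\<pi> 1 = 2" "\<pi> 4 = 3" "\<pi> 3 = 4"
          by metis
        then show ?case
        proof cases
          case 1
          show ?thesis
            using payment_ratio[OF _ uv(1) uv(2) uv(3) uv(4) l opt 1]
            by (simp add: f_def \<omega>)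
        next
          case 2
          show ?thesis
            using payment_ratio[OF _ uv(2) uv(1) uv(3) uv(4) l opt 2]
            by (simp add: f_def \<omega> add.commute)
        next
          case 3
          show ?thesis
            using payment_ratio[OF _ uv(1) uv(2) uv(4) uv(3) l opt 3]
            by (simp add: f_def \<omega> add.commute)
        next
          case 4
          show ?thesis
            using payment_ratio[OF _ uv(2) uv(1) uv(4) uv(3) l opt 4]
            by (simp add: f_def \<omega> add.commute)
        qed
      qed
    qed
    \<comment> \<open>With every expectation equal to 1, this reads
      \<open>10 \<le> 4\<close>.\<close>
    then have "(\<integral>\<omega>. 5 * (f 1 \<omega> + f 2 \<omega>) \<partial>M) \<le> (\<integral>\<omega>. 2 * (f 3 \<omega> + f 4 \<omega>) \<partial>M)"
      by (intro integral_mono_AE) (auto intro!: int)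
    then show False
      by (simp add: int E)
  qed
qed

end
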